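(* Let $1\le\gamma_1<\gamma_2<\dots<\gamma_m$ be constants ($m$ a positive integer), let $\delta=\pm1$, and let $F_1,\dots,F_N$ be continuous functions of $t$. The Euler-Poisson equations with multiple gamma law (stated in the context) have the family of solutions $$\rho(t,\vec x)=\frac{\sum_{i=1}^N C_i^2}{\alpha(N)}\,\ddot f\Big(\sum_{i=1}^N C_i(x_i-a_i(t))\Big),\quad \vec u(t,\vec x)=(\dot a_1(t),\dots,\dot a_N(t)),\quad S(t,\vec x)=\ln\Big[g\Big(\sum_{i=1}^N C_i(x_i-a_i(t))\Big)\Big],$$ where $C_1,\dots,C_N,\xi$ are arbitrary constants with $\sum_{i=1}^N C_i^2>0$, $d_1,\dots,d_N$ are arbitrary $C^0$ functions of $t$, the functions $a_i$ satisfy $$\ddot a_i(t)=F_i(t)+C_i\xi+d_i(t),\qquad i=1,\dots,N,$$ with prescribed constant initial values for $a_i(0)$ and $\dot a_i(0)$, and $f,g$ are functions of one real variable $z$ as follows. (1) For $\gamma_1>1$: $\ddot f\ge 0$ is an arbitrary $C^3$ function, and $$\xi+\frac{\alpha(N)}{\sum_{i=1}^N C_i^2}\,\dot g(z)\sum_{j=1}^m \ddot f(z)^{\gamma_j-1}+\frac{\alpha(N)}{\sum_{i=1}^N C_i^2}\,g(z)\sum_{j=1}^m\gamma_j \ddot f(z)^{\gamma_j-2}\dddot f(z)+\delta\dot f(z)=0,\qquad g(z)>0,$$ for $z\in(-\infty,\infty)$. (2) For $\gamma_1=1$: $\dddot f>0$ is an arbitrary $C^1$ function, and $$\xi+\frac{\alpha(N)}{\sum_{i=1}^N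 C_i^2}\,\dot g(z)+\frac{\alpha(N)}{\sum_{i=1}^N C_i^2}\,g(z)\frac{\dddot f(z)}{f(z)}+\frac{\alpha(N)}{\sum_{i=1}^N C_i^2}\,\dot g(z)\sum_{j=2}^m \ddot f(z)^{\gamma_j-1}+\frac{\alpha(N)}{\sum_{i=1}^N C_i^2}\,g(z)\sum_{j=2}^m\gamma_j \ddot f(z)^{\gamma_j-2}\dddot f(z)+\delta\dot f(z)=0,\qquad g(z)>0,$$ for $z\in(-\infty,\infty)$.
   Context: The constant $\alpha(N)$ is $\alpha(1)=2$, $\alpha(2)=2\pi$, and $\alpha(N)=N(N-2)\frac{\pi^{N/2}}{\Gamma(N/2+1)}$ for $N\ge 3$. The Euler-Poisson equations with multiple gamma law and time-dependent external force $\vec F(t)=(F_1(t),\dots,F_N(t))$ in $\mathbb{R}^N$, for density $\rho=\rho(t,\vec x)$, velocity $\vec u=(u_1,\dots,u_N)(t,\vec x)$, entropy $S=S(t,\vec x)$ and potential $\Phi=\Phi(t,\vec x)$, are $$\frac{\partial\rho}{\partial t}+\sum_{k=1}^N u_k\frac{\partial\rho}{\partial x_k}+\rho\sum_{k=1}^N\frac{\partial u_k}{\partial x_k}=0,$$ $$\rho\Big(\frac{\partial u_i}{\partial t}+\sum_{k=1}^N u_k\frac{\partial u_i}{\partial x_k}\Big)+\frac{\partial}{\partial x_i}\Big(e^{S}\sum_{j=1}^m\rho^{\gamma_j}\Big)=-\delta\rho\frac{\partial\Phi}{\partial x_i}+\rho F_i(t),\qquad i=1,\dots,N,$$ $$\frac{\partial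 S}{\partial t}+\sum_{k=1}^N u_k\frac{\partial S}{\partial x_k}=0,\qquad \Delta\Phi=\alpha(N)\rho,$$ with $\delta=1$ (self-gravitating) or $\delta=-1$ (repulsive), $\Delta$ being the Laplacian in $\vec x$. Dots denote derivatives of one-variable functions (with respect to $t$ for $a_i$, with respect to $z$ for $f,g$). That $(\rho,\vec u,S)$ is a solution means that the equations hold together with some potential $\Phi$.
   Formalization: With K=ΣC_i²/α(N), the printed profile equations are false: each j-th term in the sums needs a factor K^{γ_j} (so the separated γ_1=1 terms have coefficient 1, not 1/K); in (2) f'''/f is replaced by f'''/f'', and the condition f'''>0 by f''>0 (f of class C^3). *)

theory Defs
  imports "HOL-Analysis.Analysis"
begin

definition alpha :: "nat \<Rightarrow> real" where
  "alpha N =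
     (if N = 1 then 2
      else if N = 2 then 2 * pi
      else real N * (real N - 2) * (pi powr (real N / 2) / Gamma (real N / 2 + 1)))"

definition C_k_real :: "nat \<Rightarrow> (real \<Rightarrow> real) \<Rightarrow> bool" where
  "C_k_real k f \<longleftrightarrow>
     (\<forall>j<k. \<forall>z. (deriv ^^ j) f field_differentiable (at z)) \<and>
     continuous_on UNIV ((deriv ^^ k) f)"

definition partial :: "'n::finite \<Rightarrow> (real ^ 'n \<Rightarrow> real) \<Rightarrow> real ^ 'n \<Rightarrow> real" where
  "partial k h x = frechet_derivative h (at x) (axis k 1)"

definition laplacian :: "(real ^ 'n::finite \<Rightarrow> real) \<Rightarrow> real ^ 'n \<Rightarrow> real" where
  "laplacian h x = (\<Sum>k\<in>UNIV. partial k (partial k h) x)"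

text \<open>The exponents are \<gamma> 1, ..., \<gamma> m; the value \<gamma> 0 is never used.\<close>

definition pressure ::
  "nat \<Rightarrow> (nat \<Rightarrow> real) \<Rightarrow> (real \<Rightarrow> real ^ 'n::finite \<Rightarrow> real) \<Rightarrow> (real \<Rightarrow> real ^ 'n \<Rightarrow> real)
    \<Rightarrow> real \<Rightarrow> real ^ 'n \<Rightarrow> real" where
  "pressure m \<gamma> \<rho> S t x = exp (S t x) * (\<Sum>j=1..m. \<rho> t x powr \<gamma> j)"

text \<open>
  Classical solutions for all times and on the whole space. Differentiability is required
  explicitly because the derivative operators are total. The potential only has to be regular
  in the space variable, as no time derivative of it occurs. The density is required to be
  nonnegative, so that its real powers have their usual meaning.
\<close>

definition euler_poisson_with ::
  "real \<Rightarrow> nat \<Rightarrow> (nat \<Rightarrow> real) \<Rightarrow> ('n::finite \<Rightarrow> real \<Rightarrow> real)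
    \<Rightarrow> (real \<Rightarrow> real ^ 'n \<Rightarrow> real) \<Rightarrow> (real \<Rightarrow> real ^ 'n \<Rightarrow> real ^ 'n)
    \<Rightarrow> (real \<Rightarrow> real ^ 'n \<Rightarrow> real) \<Rightarrow> (real \<Rightarrow> real ^ 'n \<Rightarrow> real) \<Rightarrow> bool" where
  "euler_poisson_with \<delta> m \<gamma> F \<rho> u S \<Phi> \<longleftrightarrow>
     (\<forall>t x.
        (\<lambda>(s, y). \<rho> s y) differentiable (at (t, x)) \<and>
        (\<lambda>(s, y). u s y) differentiable (at (t, x)) \<and>
        (\<lambda>(s, y). S s y) differentiable (at (t, x)) \<and>
        pressure m \<gamma> \<rho> S t differentiable (at x) \<and>
        \<Phi> t differentiable (at x) \<and>
        (\<forall>k. partial k (\<Phi> t) differentiable (at x)) \<and>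
        \<rho> t x \<ge> 0 \<and>
        deriv (\<lambda>s. \<rho> s x) t + (\<Sum>k\<in>UNIV. u t x $ k * partial k (\<rho> t) x)
          + \<rho> t x * (\<Sum>k\<in>UNIV. partial k (\<lambda>y. u t y $ k) x) = 0 \<and>
        (\<forall>i. \<rho> t x * (deriv (\<lambda>s. u s x $ i) t
                 + (\<Sum>k\<in>UNIV. u t x $ k * partial k (\<lambda>y. u t y $ i) x))
               + partial i (pressure m \<gamma> \<rho> S t) x
             = - \<delta> * \<rho> t x * partial i (\<Phi> t) x + \<rho> t x * F i t) \<and>
        deriv (\<lambda>s. S s x) t + (\<Sum>k\<in>UNIV. u t x $ k * partial k (S t) x) = 0 \<and>
        laplacian (\<Phi> t) x = alpha CARD('n) * \<rho> t x)"

definition euler_poisson_solution ::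
  "real \<Rightarrow> nat \<Rightarrow> (nat \<Rightarrow> real) \<Rightarrow> ('n::finite \<Rightarrow> real \<Rightarrow> real)
    \<Rightarrow> (real \<Rightarrow> real ^ 'n \<Rightarrow> real) \<Rightarrow> (real \<Rightarrow> real ^ 'n \<Rightarrow> real ^ 'n)
    \<Rightarrow> (real \<Rightarrow> real ^ 'n \<Rightarrow> real) \<Rightarrow> bool" where
  "euler_poisson_solution \<delta> m \<gamma> F \<rho> u S \<longleftrightarrow> (\<exists>\<Phi>. euler_poisson_with \<delta> m \<gamma> F \<rho> u S \<Phi>)"

definition density_factor :: "real ^ 'n::finite \<Rightarrow> real" where
  "density_factor C = (\<Sum>i\<in>UNIV. (C $ i)\<^sup>2) / alpha CARD('n)"

text \<open>
  The profile equations express the momentum equation along z = C . (x - a(t)) after division by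
  the density K f''(z), where K is the density factor: since the pressure is the sum of the
  g(z) (K f''(z)) powr \<gamma> j, each of its terms carries a factor K powr \<gamma> j, and dividing
  by K f''(z) leaves (1/K) (K powr \<gamma> j). The factors K powr \<gamma> j, which do not cancel
  against 1/K unless K = 1 or \<gamma> j = 1, are missing in the published form of these equations,
  where every term has the coefficient 1/K alone; without them the claim is false in general.

  In the first equation, f'' powr (\<gamma> j - 2) is multiplied by f''', which vanishes wherever
  the nonnegative function f'' does. The convention 0 powr a = 0 hence makes the product 0 at
  such points.
\<close>

definition profile_eq_gt1 ::
  "real \<Rightarrow> nat \<Rightarrow> (nat \<Rightarrow> real) \<Rightarrow> real ^ 'n::finite \<Rightarrow> real \<Rightarrow> (real \<Rightarrow> real) \<Rightarrow> (real \<Rightarrow> real)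
    \<Rightarrow> real \<Rightarrow> bool" where
  "profile_eq_gt1 \<delta> m \<gamma> C \<xi> f g z \<longleftrightarrow>
     (let K = density_factor C; f1 = deriv f; f2 = (deriv ^^ 2) f; f3 = (deriv ^^ 3) f in
      \<xi> + 1 / K * deriv g z * (\<Sum>j=1..m. K powr \<gamma> j * f2 z powr (\<gamma> j - 1))
        + 1 / K * g z * (\<Sum>j=1..m. K powr \<gamma> j * \<gamma> j * f2 z powr (\<gamma> j - 2) * f3 z)
        + \<delta> * f1 z = 0)"

text \<open>
  For \<gamma> 1 = 1 the terms with j = 1 are separated; for them (1/K) (K powr \<gamma> 1) = 1.
  The published form has f''' / f in place of f''' / f''.
\<close>

definition profile_eq_eq1 ::
  "real \<Rightarrow> nat \<Rightarrow> (nat \<Rightarrow> real) \<Rightarrow> real ^ 'n::finite \<Rightarrow> real \<Rightarrow> (real \<Rightarrow> real) \<Rightarrow> (real \<Rightarrow> real)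
    \<Rightarrow> real \<Rightarrow> bool" where
  "profile_eq_eq1 \<delta> m \<gamma> C \<xi> f g z \<longleftrightarrow>
     (let K = density_factor C; f1 = deriv f; f2 = (deriv ^^ 2) f; f3 = (deriv ^^ 3) f in
      \<xi> + deriv g z + g z * (f3 z / f2 z)
        + 1 / K * deriv g z * (\<Sum>j=2..m. K powr \<gamma> j * f2 z powr (\<gamma> j - 1))
        + 1 / K * g z * (\<Sum>j=2..m. K powr \<gamma> j * \<gamma> j * f2 z powr (\<gamma> j - 2) * f3 z)
        + \<delta> * f1 z = 0)"

end

theory Submission
  imports Defs
begin

text \<open>
  With z = C . (x - a(t)), the density, the entropy and the pressure are travelling waves moving
  with the velocity of the fluid, so that the continuity and the entropy equation hold trivially.
  The potential f(z) - \<delta> d(t) . x solves the Poisson equation; its linear part absorbs d, and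
  what remains of the momentum equation is C times the profile equation multiplied by the density.
\<close>

lemma alpha_pos: "N \<ge> 1 \<Longrightarrow> alpha N > 0"
  by (auto simp: alpha_def intro!: mult_pos_pos divide_pos_pos Gamma_real_pos)

lemma density_factor_pos:
  "(\<Sum>i\<in>UNIV. (C $ i)\<^sup>2) > 0 \<Longrightarrow> density_factor (C :: real ^ 'n::finite) > 0"
  by (simp add: density_factor_def alpha_pos Suc_leI)

lemma partial_eqI: "(h has_derivative D) (at x) \<Longrightarrow> partial k h x = D (axis k 1)"
  by (simp add: partial_def flip: frechet_derivative_at)

section \<open>Plane waves: functions of the phase \<open>C \<bullet> (x - a(t))\<close> and their
  derivatives in space and time\<close>

definition phase :: "real ^ 'n::finite \<Rightarrow> ('n \<Rightarrow> real \<Rightarrow> real) \<Rightarrow> real \<Rightarrow> real ^ 'n \<Rightarrow> real" where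
  "phase C a t x = (\<Sum>i\<in>UNIV. C $ i * (x $ i - a i t))"

text \<open>At a fixed time the phase is affine in \<open>x\<close> with gradient \<open>C\<close>,
  so the chain rule gives a gradient parallel to \<open>C\<close>.\<close>

lemma plane_wave_has_derivative:
  assumes "(h has_real_derivative h') (at (phase C a t x))"
  shows "((\<lambda>y. h (phase C a t y)) has_derivative (\<lambda>v. h' * (C \<bullet> v))) (at x)"
proof -
  have "(phase C a t has_derivative (\<lambda>v. C \<bullet> v)) (at x)"
    unfolding phase_def inner_vec_def inner_real_def
    by (auto intro!: derivative_eq_intros bounded_linear_imp_has_derivative)
  from diff_chain_at[OF this assms[unfolded has_field_derivative_def]]
  show ?thesis by (simp add: o_def)
qed

lemma partial_plane_wave:
  assumes "(h has_real_derivative h') (at (phase C a t x))"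
  shows "partial k (\<lambda>y. h (phase C a t y)) x = C $ k * h'"
  using partial_eqI[OF plane_wave_has_derivative[OF assms]] by (simp add: inner_axis)

text \<open>The sum is arranged so that each summand is a velocity component
  \<open>deriv (a k) t\<close> times the spatial partial derivative given by
  \<open>partial_plane_wave\<close>. Hence a plane wave is annihilated by the transport operator
  along \<open>a\<close>, and the cancellation is visible to the simplifier.\<close>

lemma plane_wave_time_derivative:
  assumes "(h has_real_derivative h') (at (phase C a t x))"
    and "\<And>i. a i field_differentiable (at t)"
  shows "((\<lambda>s. h (phase C a s x)) has_real_derivative
            - (\<Sum>k\<in>UNIV. deriv (a k) t * (C $ k * h'))) (at t)"
proof -
  have "((\<lambda>s. phase C a s x) has_real_derivative (\<Sum>i\<in>UNIV. C $ i * (0 - deriv (a i) t))) (at t)"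
    unfolding phase_def
    by (intro DERIV_sum DERIV_cmult DERIV_diff DERIV_const)
       (simp add: DERIV_deriv_iff_field_differentiable assms(2))
  from DERIV_chain2[OF assms(1) this] show ?thesis
    by (rule DERIV_cong) (simp add: sum_distrib_left sum_negf mult_ac)
qed

text \<open>Joint differentiability in time and space is not a consequence of the existence of
  partial derivatives, so the phase is built from differentiable functions of the pair.\<close>

lemma plane_wave_differentiable:
  assumes "(h has_real_derivative h') (at (phase C a t x))"
    and "\<And>i. a i field_differentiable (at t)"
  shows "(\<lambda>(s, y). h (phase C a s y)) differentiable (at (t, x))"
proof -
  have a: "(\<lambda>p. a i (fst p)) differentiable (at (t, x))" for i
  proof -
    have "a i differentiable (at (fst (t, x)))"
      using assms(2) by (simp add: field_differentiable_imp_differentiable)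
    moreover have "fst differentiable (at (t, x))"
      by (intro bounded_linear_imp_differentiable bounded_linear_fst)
    ultimately show ?thesis
      using differentiable_chain_at[of fst "(t, x)" "a i"] by (simp add: o_def)
  qed
  have x: "(\<lambda>p. snd p $ i) differentiable (at (t, x))" for i
    by (intro bounded_linear_imp_differentiable
        bounded_linear_compose[OF bounded_linear_vec_nth bounded_linear_snd])
  have "(\<lambda>p. phase C a (fst p) (snd p)) differentiable (at (t, x))"
    unfolding phase_def using a x by (intro differentiable_sum differentiable_mult differentiable_diff) auto
  moreover have "h differentiable (at (phase C a (fst (t, x)) (snd (t, x))))"
    using assms(1) by (auto simp: has_field_derivative_def differentiable_def)
  ultimately show ?thesis
    using differentiable_chain_at[of "\<lambda>p. phase C a (fst p) (snd p)" "(t, x)" h]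
    by (simp add: o_def case_prod_beta')
qed

lemma spatially_constant_differentiable:
  fixes b :: "'n::finite \<Rightarrow> real \<Rightarrow> real"
  assumes "\<And>i. b i field_differentiable (at t)"
  shows "(\<lambda>(s, y). \<chi> i. b i s) differentiable (at (t, x))"
proof -
  have fst: "(fst has_derivative fst) (at (t, x))"
    by (intro bounded_linear_imp_has_derivative bounded_linear_fst)
  have "(b i has_derivative (\<lambda>v. deriv (b i) t * v)) (at (fst (t, x)))" for i
    using assms DERIV_deriv_iff_field_differentiable has_field_derivative_def by (metis fst_conv)
  from diff_chain_at[OF fst this]
  have b: "((\<lambda>p. b i (fst p)) has_derivative (\<lambda>v. deriv (b i) t * fst v)) (at (t, x))" for i
    unfolding o_def .
  have "((\<lambda>p. (\<chi> i. b i (fst p)) :: real ^ 'n) has_derivative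
      (\<lambda>v. \<chi> i. deriv (b i) t * fst v)) (at (t, x))"
  proof (subst has_derivative_componentwise_within, rule ballI)
    fix e :: "real ^ 'n"
    assume "e \<in> Basis"
    then obtain k where "e = axis k 1" by (auto simp: Basis_vec_def)
    then show "((\<lambda>p. (\<chi> i. b i (fst p)) \<bullet> e) has_derivative
        (\<lambda>v. (\<chi> i. deriv (b i) t * fst v) \<bullet> e)) (at (t, x))"
      using b[of k] by (simp add: inner_axis)
  qed
  then show ?thesis unfolding case_prod_beta' by (rule differentiableI)
qed

section \<open>Real powers of the density and the derivative of the pressure\<close>

text \<open>Where \<open>h\<close> is positive this is the chain rule. At a zero of
  \<open>h\<close>, where \<open>c > 1\<close>, the factorisation of \<open>h y powr c\<close> as
  \<open>h y * h y powr (c - 1)\<close> turns the difference quotient into that of \<open>h\<close>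
  times a factor tending to 0. The derivative is then 0, in agreement with the formula.\<close>

lemma has_real_derivative_powr_nonneg:
  fixes h :: "real \<Rightarrow> real"
  assumes h: "(h has_real_derivative h') (at z)" and nonneg: "\<And>y. h y \<ge> 0"
    and c: "c > 1 \<or> h z > 0"
  shows "((\<lambda>y. h y powr c) has_real_derivative c * h z powr (c - 1) * h') (at z)"
proof (cases "h z > 0")
  case True
  then show ?thesis using DERIV_chain2[OF has_real_derivative_powr h] by simp
next
  case False
  with nonneg[of z] c have z: "h z = 0" and c: "c > 1" by auto
  have "((\<lambda>y. (h y - h z) / (y - z)) \<longlongrightarrow> h') (at z)"
    using h by (simp add: has_field_derivative_iff)
  \<comment> \<open>The base tends to 0 here; the limit rule applies because the exponent
    \<open>c - 1\<close> is positive and \<open>h\<close> is nonnegative.\<close>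
  moreover have "((\<lambda>y. h y powr (c - 1)) \<longlongrightarrow> 0 powr (c - 1)) (at z)"
    using DERIV_isCont[OF h] c z nonneg
    by (intro tendsto_powr') (auto simp: isCont_def)
  ultimately have "((\<lambda>y. (h y - h z) / (y - z) * h y powr (c - 1)) \<longlongrightarrow> h' * 0 powr (c - 1)) (at z)"
    by (rule tendsto_mult)
  moreover have "h y * h y powr (c - 1) = h y powr c" for y
    using nonneg[of y] by (cases "h y = 0") (auto simp: powr_mult_base)
  ultimately show ?thesis using c by (simp add: has_field_derivative_iff z)
qed

text \<open>For exponent 1 the factor \<open>K powr 1\<close> cancels against \<open>1 / K\<close>,
  and the power of exponent -1 of a positive second derivative is its reciprocal. So the separated
  terms are the summands \<open>j = 1\<close> of the general equation, and both cases can be treated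
  through that equation.\<close>

lemma profile_eq_gt1_if_profile_eq_eq1:
  assumes eq: "profile_eq_eq1 \<delta> m \<gamma> C \<xi> f g z"
    and "\<gamma> 1 = 1" "m \<ge> 1" "(deriv ^^ 2) f z > 0" "density_factor C > 0"
  shows "profile_eq_gt1 \<delta> m \<gamma> C \<xi> f g z"
proof -
  have split: "sum p {1..m} = p 1 + sum p {2..m}" for p :: "nat \<Rightarrow> real"
    using \<open>m \<ge> 1\<close> by (simp add: sum.atLeast_Suc_atMost numeral_2_eq_2)
  have distrib: "1 / K * b * (K * c + A) = b * c + 1 / K * b * A" if "K > 0" for K b c A :: real
    using that by (simp add: field_simps)
  have first: "K powr \<gamma> 1 * \<phi> powr (\<gamma> 1 - 1) = K * 1"
    "K powr \<gamma> 1 * \<gamma> 1 * \<phi> powr (\<gamma> 1 - 2) * \<phi>' = K * (\<phi>' / \<phi>)"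
    if "K > 0" "\<phi> > 0" for K \<phi> \<phi>' :: real
    using that \<open>\<gamma> 1 = 1\<close> by (simp_all add: powr_minus_divide)
  show ?thesis
    using eq unfolding profile_eq_gt1_def profile_eq_eq1_def Let_def split
      first[OF assms(5,4)] distrib[OF assms(5)]
    by linarith
qed

text \<open>This is the profile equation multiplied by the density
  \<open>K * (deriv ^^ 2) f z\<close>. Multiplication, unlike division, is also sound where the
  density vanishes. Hypothesis \<open>c\<close> admits an exponent 1 only where the second
  derivative of \<open>f\<close> is positive, which covers both cases of the theorem.\<close>

lemma pressure_profile_has_derivative:
  fixes C :: "real ^ 'n::finite"
  defines "K \<equiv> density_factor C"
  assumes f2: "((deriv ^^ 2) f has_real_derivative (deriv ^^ 3) f z) (at z)"
    and g: "g field_differentiable (at z)"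
    and nonneg: "\<And>y. (deriv ^^ 2) f y \<ge> 0"
    and c: "\<And>j. j \<in> {1..m} \<Longrightarrow> \<gamma> j > 1 \<or> (deriv ^^ 2) f z > 0"
    and K: "K > 0"
    and eq: "profile_eq_gt1 \<delta> m \<gamma> C \<xi> f g z"
  shows "((\<lambda>y. g y * (\<Sum>j=1..m. (K * (deriv ^^ 2) f y) powr \<gamma> j)) has_real_derivative
           - (K * (deriv ^^ 2) f z * (\<xi> + \<delta> * deriv f z))) (at z)"
proof -
  define \<phi> where "\<phi> = (deriv ^^ 2) f"
  define \<phi>' where "\<phi>' = (deriv ^^ 3) f z"
  note [simp] = \<phi>_def[symmetric] \<phi>'_def[symmetric]
  have D: "((\<lambda>y. g y * (\<Sum>j=1..m. (K * \<phi> y) powr \<gamma> j)) has_real_derivative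
           deriv g z * (\<Sum>j=1..m. (K * \<phi> z) powr \<gamma> j)
           + (\<Sum>j=1..m. K powr \<gamma> j * (\<gamma> j * \<phi> z powr (\<gamma> j - 1) * \<phi>')) * g z) (at z)"
  proof (rule DERIV_mult)
    show "(g has_real_derivative deriv g z) (at z)"
      using g by (simp add: DERIV_deriv_iff_field_differentiable)
    have "((\<lambda>y. \<phi> y powr \<gamma> j) has_real_derivative \<gamma> j * \<phi> z powr (\<gamma> j - 1) * \<phi>') (at z)"
      if "j \<in> {1..m}" for j
      using has_real_derivative_powr_nonneg[of \<phi> \<phi>' z "\<gamma> j"] f2 nonneg c[OF that] by simp
    then have "((\<lambda>y. \<Sum>j=1..m. K powr \<gamma> j * \<phi> y powr \<gamma> j) has_real_derivative
        (\<Sum>j=1..m. K powr \<gamma> j * (\<gamma> j * \<phi> z powr (\<gamma> j - 1) * \<phi>'))) (at z)"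
      by (intro DERIV_sum DERIV_cmult)
    then show "((\<lambda>y. \<Sum>j=1..m. (K * \<phi> y) powr \<gamma> j) has_real_derivative
        (\<Sum>j=1..m. K powr \<gamma> j * (\<gamma> j * \<phi> z powr (\<gamma> j - 1) * \<phi>'))) (at z)"
      using K nonneg by (simp add: powr_mult)
  qed
  \<comment> \<open>At a zero of \<open>\<phi>\<close> both identities read 0 = 0, since
    \<open>0 powr a = 0\<close> for every \<open>a\<close>, negative exponents and 0
    included.\<close>
  have base: "\<phi> z * \<phi> z powr (c - 1) = \<phi> z powr c"
    "\<phi> z * \<phi> z powr (c - 2) = \<phi> z powr (c - 1)" for c
    using nonneg[of z] by (cases "\<phi> z = 0"; simp add: powr_mult_base)+
  have A: "\<phi> z * (\<Sum>j=1..m. K powr \<gamma> j * \<phi> z powr (\<gamma> j - 1)) = (\<Sum>j=1..m. (K * \<phi> z) powr \<gamma> j)"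
    using K nonneg[of z] by (simp add: sum_distrib_left powr_mult mult.left_commute[of "\<phi> z"] base)
  have B: "\<phi> z * (\<Sum>j=1..m. K powr \<gamma> j * \<gamma> j * \<phi> z powr (\<gamma> j - 2) * \<phi>')
      = (\<Sum>j=1..m. K powr \<gamma> j * (\<gamma> j * \<phi> z powr (\<gamma> j - 1) * \<phi>'))"
    by (simp add: sum_distrib_left mult.assoc mult.left_commute[of "\<phi> z"] flip: base(2))
  have "- (\<xi> + \<delta> * deriv f z) = 1 / K * (deriv g z * (\<Sum>j=1..m. K powr \<gamma> j * \<phi> z powr (\<gamma> j - 1))
        + g z * (\<Sum>j=1..m. K powr \<gamma> j * \<gamma> j * \<phi> z powr (\<gamma> j - 2) * \<phi>'))"
    using eq unfolding profile_eq_gt1_def Let_def K_def[symmetric] by (simp add: algebra_simps)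
  then have "K * \<phi> z * - (\<xi> + \<delta> * deriv f z)
      = deriv g z * (\<phi> z * (\<Sum>j=1..m. K powr \<gamma> j * \<phi> z powr (\<gamma> j - 1)))
        + g z * (\<phi> z * (\<Sum>j=1..m. K powr \<gamma> j * \<gamma> j * \<phi> z powr (\<gamma> j - 2) * \<phi>'))"
    using K by (simp add: algebra_simps)
  with A B have "deriv g z * (\<Sum>j=1..m. (K * \<phi> z) powr \<gamma> j)
           + (\<Sum>j=1..m. K powr \<gamma> j * (\<gamma> j * \<phi> z powr (\<gamma> j - 1) * \<phi>')) * g z
      = - (K * \<phi> z * (\<xi> + \<delta> * deriv f z))"
    by (simp add: algebra_simps)
  with D show ?thesis by (simp only: \<phi>_def)
qed

theorem theorem2:
  fixes m :: nat and \<gamma> :: "nat \<Rightarrow> real" and \<delta> \<xi> :: real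
    and F d a :: "'n::finite \<Rightarrow> real \<Rightarrow> real"
    and C a0 a1 :: "real ^ 'n"
    and f g :: "real \<Rightarrow> real"
  assumes "m \<ge> 1" and "1 \<le> \<gamma> 1" and "strict_mono_on {1..m} \<gamma>"
    and "\<delta> = 1 \<or> \<delta> = -1"
    and "\<forall>i. continuous_on UNIV (F i)"
    and "(\<Sum>i\<in>UNIV. (C $ i)\<^sup>2) > 0"
    and "\<forall>i. continuous_on UNIV (d i)"
    and "\<forall>i t. a i field_differentiable (at t)"
    and "\<forall>i t. (deriv (a i) has_real_derivative F i t + C $ i * \<xi> + d i t) (at t)"
    and "\<forall>i. a i 0 = a0 $ i" and "\<forall>i. deriv (a i) 0 = a1 $ i"
    and "C_k_real 3 f"
    and "\<forall>z. g field_differentiable (at z)" and "\<forall>z. g z > 0"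
    and "(\<gamma> 1 > 1 \<and> (\<forall>z. (deriv ^^ 2) f z \<ge> 0) \<and> (\<forall>z. profile_eq_gt1 \<delta> m \<gamma> C \<xi> f g z)) \<or>
         (\<gamma> 1 = 1 \<and> (\<forall>z. (deriv ^^ 2) f z > 0) \<and> (\<forall>z. profile_eq_eq1 \<delta> m \<gamma> C \<xi> f g z))"
  shows "euler_poisson_solution \<delta> m \<gamma> F
           (\<lambda>t x. (\<Sum>i\<in>UNIV. (C $ i)\<^sup>2) / alpha CARD('n)
                    * (deriv ^^ 2) f (\<Sum>i\<in>UNIV. C $ i * (x $ i - a i t)))
           (\<lambda>t x. \<chi> i. deriv (a i) t)
           (\<lambda>t x. ln (g (\<Sum>i\<in>UNIV. C $ i * (x $ i - a i t))))"
proof -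
  define K where "K = density_factor C"
  define f1 f2 f3 where "f1 = deriv f" and "f2 = (deriv ^^ 2) f" and "f3 = (deriv ^^ 3) f"
  define z where "z = phase C a"
  have K: "K > 0" using assms(6) by (simp add: K_def density_factor_pos)
  have alpha: "alpha CARD('n) > 0" by (simp add: alpha_pos Suc_leI)
  have da: "a i field_differentiable (at t)" for i t using assms(8) by blast
  have dda: "deriv (a i) field_differentiable (at t)"
    and dda_eq: "deriv (deriv (a i)) t = F i t + C $ i * \<xi> + d i t" for i t
    using assms(9) by (auto simp: field_differentiable_def intro: DERIV_imp_deriv)
  have diff: "(deriv ^^ j) f field_differentiable (at y)" if "j < 3" for j y
    using assms(12) that by (simp add: C_k_real_def)
  have f: "(f has_real_derivative f1 y) (at y)"
    and f1: "(f1 has_real_derivative f2 y) (at y)"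
    and f2: "(f2 has_real_derivative f3 y) (at y)" for y
    using diff[of 0 y] diff[of 1 y] diff[of 2 y]
    by (simp_all add: f1_def f2_def f3_def DERIV_deriv_iff_field_differentiable numeral_2_eq_2
        numeral_3_eq_3)
  have g: "g field_differentiable (at y)" and g_pos: "g y > 0" for y using assms(13,14) by auto
  have nonneg: "f2 y \<ge> 0" for y using assms(15) by (auto simp: f2_def less_imp_le)
  have gamma: "\<gamma> 1 \<le> \<gamma> j" if "j \<in> {1..m}" for j
    using strict_mono_onD[OF assms(3), of 1 j] that by (cases "j = 1") auto
  \<comment> \<open>In the first case all exponents exceed 1, in the second \<open>f2\<close> is
    positive everywhere; either way the powers of \<open>f2\<close> are differentiable.\<close>
  have c: "\<gamma> j > 1 \<or> f2 y > 0" if "j \<in> {1..m}" for j y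
    using assms(15) gamma[OF that] by (auto simp: f2_def)
  have eq: "profile_eq_gt1 \<delta> m \<gamma> C \<xi> f g y" for y
    using assms(1,15) K profile_eq_gt1_if_profile_eq_eq1[of \<delta> m \<gamma> C \<xi> f g y] by (auto simp: K_def)

  define \<rho> where "\<rho> = (\<lambda>t x. K * f2 (z t x))"
  define u :: "real \<Rightarrow> real ^ 'n \<Rightarrow> real ^ 'n" where "u = (\<lambda>t x. \<chi> i. deriv (a i) t)"
  define S where "S = (\<lambda>t x. ln (g (z t x)))"
  \<comment> \<open>The linear term is harmonic, and in the force
    \<open>-\<delta> * partial i (\<Phi> t) x\<close> its coefficient becomes
    \<open>\<delta> * \<delta> * d i t\<close>, which is \<open>d i t\<close>.\<close>
  define \<Phi> where "\<Phi> = (\<lambda>t x. f (z t x) - \<delta> * ((\<chi> i. d i t) \<bullet> x))"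

  have Kf2: "((\<lambda>y. K * f2 y) has_real_derivative K * f3 y) (at y)" for y
    using f2 by (rule DERIV_cmult)
  have lng: "((\<lambda>y. ln (g y)) has_real_derivative deriv g y / g y) (at y)" for y
    using g[of y] g_pos[of y]
    by (auto intro!: derivative_eq_intros simp: DERIV_deriv_iff_field_differentiable[symmetric])
  \<comment> \<open>Since \<open>exp\<close> undoes \<open>ln\<close> on the positive
    \<open>g\<close>, the pressure is again a plane wave, with the profile differentiated in
    \<open>dP\<close>.\<close>
  have P: "pressure m \<gamma> \<rho> S t = (\<lambda>x. g (z t x) * (\<Sum>j=1..m. (K * f2 (z t x)) powr \<gamma> j))" for t
    using g_pos by (auto simp: pressure_def \<rho>_def S_def)
  have dP: "((\<lambda>y. g y * (\<Sum>j=1..m. (K * f2 y) powr \<gamma> j)) has_real_derivative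
      - (K * f2 y * (\<xi> + \<delta> * f1 y))) (at y)" for y
    unfolding K_def f1_def f2_def
    using f2 g nonneg c K eq
    by (intro pressure_profile_has_derivative) (auto simp: f2_def f3_def K_def)
  have d\<Phi>: "(\<Phi> t has_derivative (\<lambda>v. f1 (z t x) * (C \<bullet> v) - \<delta> * ((\<chi> i. d i t) \<bullet> v))) (at x)" for t x
    unfolding \<Phi>_def z_def
    by (intro has_derivative_diff plane_wave_has_derivative f) (auto intro!: derivative_eq_intros)
  have partial_\<Phi>: "partial k (\<Phi> t) = (\<lambda>x. C $ k * f1 (z t x) - \<delta> * d k t)" for k t
    by (rule ext, subst partial_eqI[OF d\<Phi>]) (simp add: inner_axis)
  have dd\<Phi>: "(partial k (\<Phi> t) has_derivative (\<lambda>v. C $ k * (f2 (z t x) * (C \<bullet> v)))) (at x)" for k t x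
    unfolding partial_\<Phi> z_def
    using has_derivative_diff[OF has_derivative_mult_right[OF plane_wave_has_derivative[OF f1]]
        has_derivative_const[of "\<delta> * d k t"]]
    by simp
  have "euler_poisson_with \<delta> m \<gamma> F \<rho> u S \<Phi>"
    unfolding euler_poisson_with_def
  proof (intro allI conjI)
    fix t and x :: "real ^ 'n" and i k :: 'n
    \<comment> \<open>The velocity depends on time only, so the divergence and the convective
      acceleration vanish.\<close>
    have partial_u: "partial j (\<lambda>y. u t y $ l) x = 0" for j l
      using partial_eqI[OF has_derivative_const] by (simp add: u_def)
    show "(\<lambda>(s, y). \<rho> s y) differentiable (at (t, x))"
      unfolding \<rho>_def z_def using Kf2 da by (rule plane_wave_differentiable)
    show "(\<lambda>(s, y). u s y) differentiable (at (t, x))"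
      unfolding u_def using dda by (rule spatially_constant_differentiable)
    show "(\<lambda>(s, y). S s y) differentiable (at (t, x))"
      unfolding S_def z_def using lng da by (rule plane_wave_differentiable)
    show "pressure m \<gamma> \<rho> S t differentiable (at x)"
      unfolding P z_def unfolding differentiable_def
      by (rule exI, rule plane_wave_has_derivative[OF dP])
    show "\<Phi> t differentiable (at x)" using d\<Phi> by (auto simp: differentiable_def)
    show "partial k (\<Phi> t) differentiable (at x)" using dd\<Phi> by (auto simp: differentiable_def)
    show "\<rho> t x \<ge> 0" using K nonneg by (simp add: \<rho>_def)
    show "deriv (\<lambda>s. \<rho> s x) t + (\<Sum>k\<in>UNIV. u t x $ k * partial k (\<rho> t) x)
          + \<rho> t x * (\<Sum>k\<in>UNIV. partial k (\<lambda>y. u t y $ k) x) = 0"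
      unfolding partial_u \<rho>_def z_def DERIV_imp_deriv[OF plane_wave_time_derivative[where a = a, OF Kf2 da]]
        partial_plane_wave[OF Kf2]
      by (simp add: u_def)
    show "deriv (\<lambda>s. S s x) t + (\<Sum>k\<in>UNIV. u t x $ k * partial k (S t) x) = 0"
      unfolding S_def z_def DERIV_imp_deriv[OF plane_wave_time_derivative[where a = a, OF lng da]]
        partial_plane_wave[OF lng]
      by (simp add: u_def)
    \<comment> \<open>The \<xi>-part of this pressure gradient cancels the term
      \<open>C $ i * \<xi>\<close> of the acceleration, and the \<open>f1\<close>-part balances the
      force of the plane-wave part of \<open>\<Phi>\<close>.\<close>
    have "partial i (pressure m \<gamma> \<rho> S t) x = - (C $ i * (\<rho> t x * (\<xi> + \<delta> * f1 (z t x))))"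
      unfolding P z_def partial_plane_wave[OF dP] by (simp add: \<rho>_def z_def)
    moreover have "\<delta> * \<delta> = 1" using assms(4) by auto
    then have "\<rho> t x * (\<delta> * (\<delta> * d i t)) = \<rho> t x * d i t" by (simp flip: mult.assoc)
    ultimately show "\<rho> t x * (deriv (\<lambda>s. u s x $ i) t
                 + (\<Sum>k\<in>UNIV. u t x $ k * partial k (\<lambda>y. u t y $ i) x))
               + partial i (pressure m \<gamma> \<rho> S t) x
             = - \<delta> * \<rho> t x * partial i (\<Phi> t) x + \<rho> t x * F i t"
      by (simp only: partial_u partial_\<Phi>) (simp add: u_def dda_eq algebra_simps)
    have "laplacian (\<Phi> t) x = (\<Sum>k\<in>UNIV. (C $ k)\<^sup>2) * f2 (z t x)"
      unfolding laplacian_def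
      by (simp add: partial_eqI[OF dd\<Phi>] inner_axis sum_distrib_right power2_eq_square
          mult.assoc mult.commute[of "f2 _"])
    \<comment> \<open>The density factor is normalised for this identity:
      \<open>alpha CARD('n) * K\<close> is the sum of the squares of the
      \<open>C $ k\<close>.\<close>
    also have "\<dots> = alpha CARD('n) * \<rho> t x"
      using alpha by (simp add: \<rho>_def K_def density_factor_def)
    finally show "laplacian (\<Phi> t) x = alpha CARD('n) * \<rho> t x" .
  qed
  then have "euler_poisson_solution \<delta> m \<gamma> F \<rho> u S"
    unfolding euler_poisson_solution_def by (intro exI[of _ \<Phi>])
  then show ?thesis
    by (simp only: \<rho>_def u_def S_def z_def phase_def K_def density_factor_def f2_def)
qed

end
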